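(* Let $n>1$ and let $A=[a_{ij}]$ be a real $n\times n$ matrix with $a_{ii}>0$ and $\sum_{j=1}^n|a_{ij}|=1$ for all $i\in[n]$, and let $\mathbb{G}$ be the signed digraph of $A$. Suppose that $\mathbb{G}$ is structurally unbalanced, rooted, but not strongly connected. Let $\mathcal{R}$ be the set of roots of $\mathbb{G}$ and let $\mathbb{G}_{\mathcal{R}}$ be the (signed) subgraph of $\mathbb{G}$ induced by $\mathcal{R}$. If $\mathbb{G}_{\mathcal{R}}$ is structurally unbalanced, then all the eigenvalues of $A$ are less than $1$ in magnitude. If $\mathbb{G}_{\mathcal{R}}$ is structurally balanced, then $A$ has an eigenvalue at $1$ and all the remaining eigenvalues (the $n$ eigenvalues being counted with algebraic multiplicity) are less than $1$ in magnitude.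
   Context: $[n]=\{1,\ldots,n\}$. The signed digraph of $A$ has vertex set $[n]$ and an arc $(i,j)$ from $i$ to $j$ exactly when $a_{ji}\neq 0$; the sign of $(i,j)$ is the sign of $a_{ji}$. A digraph is strongly connected if (ignoring signs) there is a directed path between each ordered pair of distinct vertices. It is rooted if it contains a directed spanning tree, i.e. there is a vertex (a root) from which every other vertex is reachable along a directed path; the set of roots consists of all such vertices. A signed digraph is structurally balanced if its vertices can be partitioned into two sets (one possibly empty) such that each arc connecting two vertices in the same set is positive and each arc connecting two vertices in different sets is negative; otherwise it is structurally unbalanced. *)

theory Defs
  imports
    Complex_Main
    "HOL-Computational_Algebra.Fundamental_Theorem_Algebra"
    "Jordan_Normal_Form.Char_Poly"
    "Graph_Theory.Digraph"
    "Graph_Theory.Digraph_Component"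
begin

text \<open>
  A signed digraph is given by a digraph \<open>G\<close> together with a function \<open>\<sigma>\<close> assigning to each arc
  its sign, \<open>1\<close> or \<open>-1\<close>. The values of \<open>\<sigma>\<close> outside \<open>arcs G\<close> are irrelevant, so a subgraph
  of a signed digraph carries the same \<open>\<sigma>\<close>. Matrix indices, and hence vertices, are
  \<open>0, \<dots>, n - 1\<close>.
\<close>

text \<open>The transposition is intended: the arc \<open>(i, j)\<close> belongs to the entry in row \<open>j\<close>, column \<open>i\<close>.\<close>

definition matrix_digraph :: "real mat \<Rightarrow> (nat, nat \<times> nat) pre_digraph" where
  "matrix_digraph A =
     \<lparr> verts = {0..<dim_row A},
       arcs = {(i, j). i < dim_row A \<and> j < dim_row A \<and> A $$ (j, i) \<noteq> 0},
       tail = fst, head = snd \<rparr>"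

definition matrix_arc_sign :: "real mat \<Rightarrow> nat \<times> nat \<Rightarrow> real" where
  "matrix_arc_sign A = (\<lambda>(i, j). sgn (A $$ (j, i)))"

definition roots :: "('a, 'b) pre_digraph \<Rightarrow> 'a set" where
  "roots G = {r \<in> verts G. \<forall>v \<in> verts G. v \<noteq> r \<longrightarrow> r \<rightarrow>\<^sup>*\<^bsub>G\<^esub> v}"

definition rooted :: "('a, 'b) pre_digraph \<Rightarrow> bool" where
  "rooted G \<longleftrightarrow> roots G \<noteq> {}"

text \<open>Loops are arcs joining two vertices of the same set, and so must be positive.\<close>

definition structurally_balanced :: "('a, 'b) pre_digraph \<Rightarrow> ('b \<Rightarrow> real) \<Rightarrow> bool" where
  "structurally_balanced G \<sigma> \<longleftrightarrow>
     (\<exists>V\<^sub>1 V\<^sub>2. V\<^sub>1 \<union> V\<^sub>2 = verts G \<and> V\<^sub>1 \<inter> V\<^sub>2 = {} \<and>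
        (\<forall>e \<in> arcs G.
           (tail G e \<in> V\<^sub>1 \<and> head G e \<in> V\<^sub>1 \<or> tail G e \<in> V\<^sub>2 \<and> head G e \<in> V\<^sub>2
              \<longrightarrow> \<sigma> e = 1) \<and>
           (tail G e \<in> V\<^sub>1 \<and> head G e \<in> V\<^sub>2 \<or> tail G e \<in> V\<^sub>2 \<and> head G e \<in> V\<^sub>1
              \<longrightarrow> \<sigma> e = -1)))"

abbreviation structurally_unbalanced :: "('a, 'b) pre_digraph \<Rightarrow> ('b \<Rightarrow> real) \<Rightarrow> bool" where
  "structurally_unbalanced G \<sigma> \<equiv> \<not> structurally_balanced G \<sigma>"

text \<open>The eigenvalues of a real matrix are its complex ones; the multiset below counts them with
  algebraic multiplicity.\<close>

abbreviation complexify :: "real mat \<Rightarrow> complex mat" where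
  "complexify A \<equiv> map_mat complex_of_real A"

definition eigenvalue_mset :: "complex mat \<Rightarrow> complex multiset" where
  "eigenvalue_mset A = proots (char_poly A)"

end

theory Submission
  imports Defs "Jordan_Normal_Form.Schur_Decomposition"
begin

text \<open>
  The sum of the moduli in each row is \<open>1\<close>, so \<open>A\<close> does not increase the maximum norm, and the
  theorem describes the case of equality. Let \<open>A x = \<mu> x\<close> with \<open>\<bar>\<mu>\<bar> \<ge> 1\<close>, and let \<open>\<bar>x\<^sub>i\<bar>\<close> be
  maximal. Then \<open>\<mu> x\<^sub>i\<close> is a combination of the entries of \<open>x\<close> with coefficients of total modulus
  \<open>1\<close>, so all terms of the combination point in the same direction and every \<open>x\<^sub>j\<close> with
  \<open>a\<^sub>i\<^sub>j \<noteq> 0\<close> has maximal modulus as well. The positive diagonal term forces \<open>\<mu> = 1\<close>, and the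
  others say \<open>x\<^sub>j = sgn(a\<^sub>i\<^sub>j) x\<^sub>i\<close> (\<open>extremal_row\<close>). Hence the set of maximal entries is closed under
  in-neighbours; since each root reaches every vertex, it contains all roots
  (\<open>peripheral_eigenvector\<close>). Everything follows from this.

  Divide \<open>x\<close> by its value at one root. On the roots this gives values \<open>\<plusminus>1\<close> whose products along
  arcs are the signs of the arcs, so the roots induce a balanced graph
  (\<open>balanced_if_peripheral_eigenvalue\<close>). If they do not, no such \<open>x\<close> exists.

  Conversely, if the roots induce a balanced graph, a vector \<open>d\<close> of signs is fixed by the rows of
  the roots, because these rows are supported on the roots. The remaining rows of the equation
  \<open>A x = x\<close> can be solved with \<open>x = d\<close> prescribed on the roots, since an obstruction would be a
  fixed vector that vanishes on the roots (\<open>eigenvalue_one_if_balanced\<close>). Finally, if \<open>1\<close> were a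
  multiple eigenvalue, there would be independent \<open>v\<close>, \<open>w\<close> with \<open>A v = v\<close> and
  \<open>A w = w + c v\<close>. A nonzero \<open>c\<close> makes the iterates \<open>w + k c v\<close> unbounded, whereas \<open>c = 0\<close>
  provides a combination of \<open>v\<close> and \<open>w\<close> that is fixed and vanishes at a root
  (\<open>eigenvalue_one_simple\<close>).
\<close>

section \<open>Balanced graphs and switching functions\<close>

text \<open>
  Products of signs replace the case distinction over the two sides of a bipartition: the
  function \<open>d\<close> is \<open>1\<close> on one side and \<open>-1\<close> on the other. This is the form in which balance is
  read off from an eigenvector, and in which it produces one.
\<close>

lemma structurally_balanced_iff_switching:
  assumes "wf_digraph G"
  shows "structurally_balanced G \<sigma> \<longleftrightarrow>
    (\<exists>d. (\<forall>v \<in> verts G. d v \<in> {1, -1}) \<and>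
      (\<forall>e \<in> arcs G. \<sigma> e = d (tail G e) * d (head G e)))"
    (is "_ \<longleftrightarrow> (\<exists>d. ?switching d)")
proof
  interpret wf_digraph G by fact
  assume "structurally_balanced G \<sigma>"
  then obtain V W where *: "V \<union> W = verts G" "V \<inter> W = {}"
    "\<forall>e \<in> arcs G.
      (tail G e \<in> V \<and> head G e \<in> V \<or> tail G e \<in> W \<and> head G e \<in> W \<longrightarrow> \<sigma> e = 1) \<and>
      (tail G e \<in> V \<and> head G e \<in> W \<or> tail G e \<in> W \<and> head G e \<in> V \<longrightarrow> \<sigma> e = -1)"
    unfolding structurally_balanced_def by metis
  have "\<sigma> e = (if tail G e \<in> V then 1 else -1) * (if head G e \<in> V then 1 else -1)"
    if "e \<in> arcs G" for e
  proof -
    have "tail G e \<in> V \<union> W" "head G e \<in> V \<union> W"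
      using that *(1) by auto
    then show ?thesis using that *(3) by auto
  qed
  then have "?switching (\<lambda>v. if v \<in> V then 1 else -1)" by simp
  then show "\<exists>d. ?switching d" by (rule exI[of "\<lambda>d. ?switching d"])
next
  interpret wf_digraph G by fact
  assume "\<exists>d. ?switching d"
  then obtain d where d: "?switching d" by blast
  have "{v \<in> verts G. d v = 1} \<union> {v \<in> verts G. d v = -1} = verts G"
    using d by auto
  moreover have "{v \<in> verts G. d v = 1} \<inter> {v \<in> verts G. d v = -1} = {}"
    by auto
  ultimately show "structurally_balanced G \<sigma>"
    unfolding structurally_balanced_def using d
    by (intro exI[of _ "{v \<in> verts G. d v = 1}"] exI[of _ "{v \<in> verts G. d v = -1}"]) auto
qed

section \<open>Vectors witnessing a repeated eigenvalue\<close>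

text \<open>
  In a Schur form of \<open>C\<close> the eigenvalues can appear on the diagonal in any order. If \<open>\<mu>\<close> occupies
  the first two places, the first two columns of the upper triangular matrix have the required
  shape, and the change of basis carries the first two unit vectors to \<open>v\<close> and \<open>w\<close>.
  A vanishing \<open>c\<close> is possible: then the eigenspace has dimension at least two.
\<close>

lemma repeated_eigenvalue_chain:
  assumes C: "C \<in> carrier_mat n n" and mult: "count (eigenvalue_mset C) \<mu> \<ge> 2"
  obtains v w c where "v \<in> carrier_vec n" "w \<in> carrier_vec n" "v \<noteq> 0\<^sub>v n"
    "\<forall>k. w \<noteq> k \<cdot>\<^sub>v v" "C *\<^sub>v v = \<mu> \<cdot>\<^sub>v v" "C *\<^sub>v w = \<mu> \<cdot>\<^sub>v w + c \<cdot>\<^sub>v v"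
proof -
  obtain as where as: "char_poly C = (\<Prod>a\<leftarrow>as. [:- a, 1:])" "length as = n"
    using char_poly_factorized[OF C] by blast
  have "proots (\<Prod>a\<leftarrow>as. [:- a, 1:]) = mset as"
  proof (induction as)
    case (Cons a as)
    have "(\<Prod>a\<leftarrow>as. [:- a, 1:]) \<noteq> 0"
      by (auto simp: prod_list_zero_iff)
    then have "proots ([:- a, 1:] * (\<Prod>a\<leftarrow>as. [:- a, 1:])) = add_mset a (mset as)"
      by (subst proots_mult) (auto simp: Cons.IH simp del: mult_pCons_left)
    then show ?case by simp
  qed simp
  then have count: "count (mset as) \<mu> \<ge> 2"
    using mult as by (simp add: eigenvalue_mset_def)
  define es where "es = \<mu> # \<mu> # remove1 \<mu> (remove1 \<mu> as)"
  have "\<mu> \<in># mset as" "\<mu> \<in># mset as - {#\<mu>#}"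
    using count by (simp_all only: count_greater_zero_iff[symmetric] count_diff count_single) simp_all
  then have mset_es: "mset es = mset as"
    unfolding es_def by (simp del: set_mset_mset in_multiset_in_set flip: diff_diff_add_mset)
  have "char_poly C = (\<Prod>e\<leftarrow>es. [:- e, 1:])"
    using mset_es by (metis as(1) mset_map prod_mset_prod_list)
  moreover obtain T P Q where "schur_decomposition C es = (T, P, Q)"
    by (metis prod_cases3)
  ultimately have wit: "similar_mat_wit C T P Q" and "upper_triangular T" "diag_mat T = es"
    using schur_decomposition[OF C] by blast+
  note w = similar_mat_witD2[OF C wit]
  have n: "2 \<le> n"
    using mset_es as(2) es_def by (metis mset_eq_length length_Cons le_add2 add_2_eq_Suc' size_mset)
  have "T $$ (i, i) = es ! i" if "i < n" for i
    using \<open>diag_mat T = es\<close> w(5) that by (auto simp: diag_mat_def)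
  then have T: "T $$ (0, 0) = \<mu>" "T $$ (1, 1) = \<mu>"
    using n by (simp_all add: es_def)
  define c where "c = T $$ (0, 1)"
  have T0: "T *\<^sub>v unit_vec n 0 = \<mu> \<cdot>\<^sub>v unit_vec n 0"
    using w(5) n T \<open>upper_triangular T\<close> unfolding upper_triangular_def
    by (intro eq_vecI) auto
  have T1: "T *\<^sub>v unit_vec n 1 = \<mu> \<cdot>\<^sub>v unit_vec n 1 + c \<cdot>\<^sub>v unit_vec n 0"
  proof (intro eq_vecI)
    fix i assume i: "i < dim_vec (\<mu> \<cdot>\<^sub>v unit_vec n 1 + c \<cdot>\<^sub>v unit_vec n 0)"
    consider "i = 0" | "i = 1" | "i > 1" by linarith
    then show "(T *\<^sub>v unit_vec n 1) $ i = (\<mu> \<cdot>\<^sub>v unit_vec n 1 + c \<cdot>\<^sub>v unit_vec n 0) $ i"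
      using w(5) n T i \<open>upper_triangular T\<close> unfolding upper_triangular_def c_def
      by cases auto
  qed (use w(5) in auto)
  have QP: "Q *\<^sub>v (P *\<^sub>v x) = x" if "x \<in> carrier_vec n" for x
    using w(2,6,7) that by (simp flip: assoc_mult_mat_vec[of Q n n P n])
  have CP: "C *\<^sub>v (P *\<^sub>v x) = P *\<^sub>v (T *\<^sub>v x)" if "x \<in> carrier_vec n" for x
  proof -
    have "C *\<^sub>v (P *\<^sub>v x) = P *\<^sub>v (T *\<^sub>v (Q *\<^sub>v (P *\<^sub>v x)))"
      unfolding w(3) using w(5-7) that by (simp add: assoc_mult_mat_vec[of _ n n _ n])
    then show ?thesis
      by (simp add: QP[OF that])
  qed
  show thesis
  proof
    show "P *\<^sub>v unit_vec n 0 \<noteq> 0\<^sub>v n"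
    proof
      assume "P *\<^sub>v unit_vec n 0 = 0\<^sub>v n"
      moreover have "Q *\<^sub>v 0\<^sub>v n = 0\<^sub>v n"
        using w(7) by (intro eq_vecI) auto
      ultimately have "unit_vec n 0 = (0\<^sub>v n :: complex vec)"
        using QP[of "unit_vec n 0"] by simp
      then have "unit_vec n 0 $ 0 = (0\<^sub>v n :: complex vec) $ 0"
        by (rule arg_cong)
      then show False
        using n by simp
    qed
    show "\<forall>k. P *\<^sub>v unit_vec n 1 \<noteq> k \<cdot>\<^sub>v (P *\<^sub>v unit_vec n 0)"
    proof (intro allI notI)
      fix k assume "P *\<^sub>v unit_vec n 1 = k \<cdot>\<^sub>v (P *\<^sub>v unit_vec n 0)"
      then have "P *\<^sub>v unit_vec n 1 = P *\<^sub>v (k \<cdot>\<^sub>v unit_vec n 0)"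
        using w(6) by (simp add: mult_mat_vec)
      then have "unit_vec n 1 = k \<cdot>\<^sub>v (unit_vec n 0 :: complex vec)"
        by (metis QP smult_carrier_vec unit_vec_carrier)
      then have "unit_vec n 1 $ 1 = (k \<cdot>\<^sub>v (unit_vec n 0 :: complex vec)) $ 1"
        by (rule arg_cong)
      then show False
        using n by simp
    qed
    show "C *\<^sub>v (P *\<^sub>v unit_vec n 0) = \<mu> \<cdot>\<^sub>v (P *\<^sub>v unit_vec n 0)"
      using w(5-7) by (simp add: CP T0 mult_mat_vec)
    show "C *\<^sub>v (P *\<^sub>v unit_vec n 1) = \<mu> \<cdot>\<^sub>v (P *\<^sub>v unit_vec n 1) + c \<cdot>\<^sub>v (P *\<^sub>v unit_vec n 0)"
      using w(5-7) by (simp add: CP T1[simplified] mult_add_distrib_mat_vec mult_mat_vec)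
  qed (use w(6) in auto)
qed

section \<open>Matrices with absolute row sums one\<close>

locale signed_stochastic_matrix =
  fixes n :: nat and A :: "real mat"
  assumes A: "A \<in> carrier_mat n n"
    and diagonal_pos: "\<And>i. i < n \<Longrightarrow> A $$ (i, i) > 0"
    and abs_row_sum: "\<And>i. i < n \<Longrightarrow> (\<Sum>j = 0..<n. \<bar>A $$ (i, j)\<bar>) = 1"
begin

abbreviation C :: "complex mat" where "C \<equiv> complexify A"
abbreviation G :: "(nat, nat \<times> nat) pre_digraph" where "G \<equiv> matrix_digraph A"

lemma C: "C \<in> carrier_mat n n"
  using A by simp

lemma verts_G [simp]: "verts G = {0..<n}"
  using A by (simp add: matrix_digraph_def)

lemma tail_G [simp]: "tail G = fst" and head_G [simp]: "head G = snd"
  by (simp_all add: matrix_digraph_def)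

lemma arcs_G: "(j, i) \<in> arcs G \<longleftrightarrow> i < n \<and> j < n \<and> A $$ (i, j) \<noteq> 0"
  using A by (auto simp: matrix_digraph_def)

sublocale digraph: wf_digraph G
  by unfold_locales (auto simp: arcs_G)

lemma adjacent_G: "j \<rightarrow>\<^bsub>G\<^esub> i \<longleftrightarrow> i < n \<and> j < n \<and> A $$ (i, j) \<noteq> 0"
proof -
  have "j \<rightarrow>\<^bsub>G\<^esub> i \<longleftrightarrow> (j, i) \<in> arcs G"
    by (force simp: arcs_ends_def arc_to_ends_def)
  then show ?thesis by (simp add: arcs_G)
qed

lemma roots_less: "r \<in> roots G \<Longrightarrow> r < n"
  by (simp add: roots_def)

lemma root_reaches: "r \<in> roots G \<Longrightarrow> i < n \<Longrightarrow> r \<rightarrow>\<^sup>*\<^bsub>G\<^esub> i"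
  by (cases "i = r") (auto simp: roots_def)

text \<open>
  In terms of \<open>A\<close>: the row of a root has its nonzero entries in columns of roots only.
\<close>

lemma root_if_adjacent_to_root:
  assumes "j \<rightarrow>\<^bsub>G\<^esub> r" "r \<in> roots G"
  shows "j \<in> roots G"
proof -
  have "j \<rightarrow>\<^sup>*\<^bsub>G\<^esub> i" if "i < n" for i
    using assms(1) root_reaches[OF assms(2) that] by (rule digraph.adj_reachable_trans)
  moreover have "j < n"
    using assms(1) by (simp add: adjacent_G)
  ultimately show ?thesis
    by (simp add: roots_def)
qed

lemma mult_entry:
  assumes "x \<in> carrier_vec n" "i < n"
  shows "(C *\<^sub>v x) $ i = (\<Sum>j = 0..<n. of_real (A $$ (i, j)) * x $ j)"
  using assms A by (auto simp: scalar_prod_def)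

lemma mult_entry_bound:
  assumes "x \<in> carrier_vec n" "i < n" "\<And>j. j < n \<Longrightarrow> cmod (x $ j) \<le> M"
  shows "cmod ((C *\<^sub>v x) $ i) \<le> M"
proof -
  have "cmod ((C *\<^sub>v x) $ i) \<le> (\<Sum>j = 0..<n. \<bar>A $$ (i, j)\<bar> * cmod (x $ j))"
    unfolding mult_entry[OF assms(1,2)]
    by (rule order_trans[OF norm_sum]) (simp add: norm_mult)
  also have "\<dots> \<le> (\<Sum>j = 0..<n. \<bar>A $$ (i, j)\<bar> * M)"
    using assms(3) by (intro sum_mono mult_left_mono) auto
  also have "\<dots> = M"
    using abs_row_sum[OF assms(2)] by (simp flip: sum_distrib_right)
  finally show ?thesis .
qed

section \<open>Eigenvalues of modulus at least one\<close>

text \<open>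
  The equality case of the triangle inequality in a row where an eigenvector has an entry of
  maximal modulus.
\<close>

lemma extremal_row:
  assumes x: "x \<in> carrier_vec n" and i: "i < n" "x $ i \<noteq> 0"
    and max: "\<And>j. j < n \<Longrightarrow> cmod (x $ j) \<le> cmod (x $ i)"
    and row: "(C *\<^sub>v x) $ i = \<mu> * x $ i" and \<mu>: "cmod \<mu> \<ge> 1"
  shows "\<mu> = 1"
    and "\<And>j. j < n \<Longrightarrow> A $$ (i, j) \<noteq> 0 \<Longrightarrow> x $ j = of_real (sgn (A $$ (i, j))) * x $ i"
proof -
  \<comment> \<open>The factor \<open>cnj \<mu> / \<bar>\<mu>\<bar>\<close> rotates \<open>\<mu>\<close> onto the positive axis, so that it is enough
      to compare real parts.\<close>
  define z where "z j = x $ j / x $ i * (cnj \<mu> / cmod \<mu>)" for j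
  have z_le: "cmod (z j) \<le> 1" if "j < n" for j
    using max[OF that] \<mu> i by (simp add: z_def norm_mult norm_divide divide_le_eq_1)
  have "(\<Sum>j = 0..<n. of_real (A $$ (i, j)) * z j)
      = (C *\<^sub>v x) $ i / x $ i * (cnj \<mu> / cmod \<mu>)"
    unfolding mult_entry[OF x i(1)] z_def sum_divide_distrib sum_distrib_right
    by (intro sum.cong) auto
  also have "\<dots> = cmod \<mu>"
  proof -
    have "\<mu> * cnj \<mu> = of_real (cmod \<mu>) * of_real (cmod \<mu>)"
      by (simp add: complex_norm_square[symmetric] power2_eq_square)
    moreover have "cmod \<mu> \<noteq> 0" using \<mu> by linarith
    ultimately show ?thesis
      using i by (simp add: row)
  qed
  finally have "Re (\<Sum>j = 0..<n. of_real (A $$ (i, j)) * z j) = cmod \<mu>"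
    by simp
  then have sum: "(\<Sum>j = 0..<n. A $$ (i, j) * Re (z j)) = cmod \<mu>"
    by simp
  have term_le: "A $$ (i, j) * Re (z j) \<le> \<bar>A $$ (i, j)\<bar>" if "j < n" for j
  proof -
    have "\<bar>Re (z j)\<bar> \<le> 1"
      using z_le[OF that] abs_Re_le_cmod[of "z j"] by linarith
    then have "\<bar>A $$ (i, j) * Re (z j)\<bar> \<le> \<bar>A $$ (i, j)\<bar>"
      by (simp add: abs_mult mult_left_le)
    then show ?thesis by linarith
  qed
  have "(\<Sum>j = 0..<n. \<bar>A $$ (i, j)\<bar> - A $$ (i, j) * Re (z j)) = 1 - cmod \<mu>"
    using abs_row_sum[OF i(1)] sum by (simp add: sum_subtractf)
  moreover have "0 \<le> (\<Sum>j = 0..<n. \<bar>A $$ (i, j)\<bar> - A $$ (i, j) * Re (z j))"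
    using term_le by (intro sum_nonneg) auto
  ultimately have "(\<Sum>j = 0..<n. \<bar>A $$ (i, j)\<bar> - A $$ (i, j) * Re (z j)) = 0"
    and norm_\<mu>: "cmod \<mu> = 1"
    using \<mu> by linarith+
  then have tight: "A $$ (i, j) * Re (z j) = \<bar>A $$ (i, j)\<bar>" if "j < n" for j
    using term_le that by (subst (asm) sum_nonneg_eq_0_iff) auto
  have z: "z j = of_real (sgn (A $$ (i, j)))" if "j < n" "A $$ (i, j) \<noteq> 0" for j
  proof -
    have Re: "Re (z j) = sgn (A $$ (i, j))"
      using tight[OF that(1)] that(2)
      by (simp add: abs_sgn[of "A $$ (i, j)"] mult.commute)
    then have "(Re (z j))\<^sup>2 = 1"
      using that(2) by (simp add: sgn_if)
    moreover have "(Re (z j))\<^sup>2 + (Im (z j))\<^sup>2 \<le> 1"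
      using z_le[OF that(1)] by (simp add: cmod_def)
    ultimately have "Im (z j) = 0"
      by simp
    with Re show ?thesis by (simp add: complex_eq_iff)
  qed
  \<comment> \<open>The diagonal entry is positive, and \<open>z i\<close> is the rotation factor itself.\<close>
  have "cnj \<mu> = 1"
    using z[of i] diagonal_pos[OF i(1)] i norm_\<mu> by (simp add: z_def)
  then show "\<mu> = 1"
    by (metis complex_cnj_cnj complex_cnj_one)
  with z i show "x $ j = of_real (sgn (A $$ (i, j))) * x $ i"
    if "j < n" "A $$ (i, j) \<noteq> 0" for j
    using that by (simp add: z_def field_simps)
qed

text \<open>
  By \<open>extremal_row\<close>, maximality of the modulus propagates against the arcs, from a maximal entry
  to every vertex that reaches it, hence to all roots.
\<close>

lemma peripheral_eigenvector:
  assumes x: "x \<in> carrier_vec n" "x \<noteq> 0\<^sub>v n" and ev: "C *\<^sub>v x = \<mu> \<cdot>\<^sub>v x" and \<mu>: "cmod \<mu> \<ge> 1"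
  shows "\<mu> = 1"
    and "\<And>r. r \<in> roots G \<Longrightarrow> x $ r \<noteq> 0"
    and "\<And>r j. r \<in> roots G \<Longrightarrow> j < n \<Longrightarrow> A $$ (r, j) \<noteq> 0 \<Longrightarrow>
      x $ j = of_real (sgn (A $$ (r, j))) * x $ r"
proof -
  define maximal where "maximal i \<longleftrightarrow> i < n \<and> (\<forall>j<n. cmod (x $ j) \<le> cmod (x $ i))" for i
  obtain k where k: "k < n" "x $ k \<noteq> 0"
    using x by (metis carrier_vecD eq_vecI index_zero_vec)
  have nz: "x $ i \<noteq> 0" if "maximal i" for i
    using that k by (force simp: maximal_def)
  have row: "(C *\<^sub>v x) $ i = \<mu> * x $ i" if "i < n" for i
    using ev x that by simp
  have max_step: "\<mu> = 1 \<and> (\<forall>j<n. A $$ (i, j) \<noteq> 0 \<longrightarrow> x $ j = of_real (sgn (A $$ (i, j))) * x $ i)"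
    if "maximal i" for i
  proof -
    have i: "i < n" "\<And>j. j < n \<Longrightarrow> cmod (x $ j) \<le> cmod (x $ i)"
      using that by (auto simp: maximal_def)
    show ?thesis
      using extremal_row[OF x(1) i(1) nz[OF that] i(2) row[OF i(1)] \<mu>] by blast
  qed
  let ?moduli = "(\<lambda>i. cmod (x $ i)) ` {0..<n}"
  have "Max ?moduli \<in> ?moduli"
    using k by (intro Max_in) auto
  then obtain m where "m < n" "cmod (x $ m) = Max ?moduli"
    by auto
  moreover have "cmod (x $ j) \<le> Max ?moduli" if "j < n" for j
    using that by (intro Max_ge) auto
  ultimately have m: "maximal m"
    by (simp add: maximal_def)
  then show "\<mu> = 1" using max_step by blast
  have "maximal r" if "r \<rightarrow>\<^sup>*\<^bsub>G\<^esub> m" for r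
    using that
  proof (induction rule: digraph.converse_reachable_induct)
    case base
    show ?case by fact
  next
    case (step j i)
    then have j: "A $$ (i, j) \<noteq> 0" "j < n"
      by (auto simp: adjacent_G)
    then have "x $ j = of_real (sgn (A $$ (i, j))) * x $ i"
      using max_step[OF step.IH] by blast
    then have "cmod (x $ j) = cmod (x $ i)"
      using j(1) by (simp add: norm_mult sgn_if)
    with \<open>j < n\<close> step.IH show ?case by (simp add: maximal_def)
  qed
  then have root: "maximal r" if "r \<in> roots G" for r
    using m root_reaches that by (auto simp: maximal_def)
  show "x $ r \<noteq> 0" if "r \<in> roots G" for r
    using nz root that by blast
  show "x $ j = of_real (sgn (A $$ (r, j))) * x $ r"
    if "r \<in> roots G" "j < n" "A $$ (r, j) \<noteq> 0" for r j
    using max_step root that by blast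
qed

section \<open>Eigenvalues and balance of the root graph\<close>

text \<open>
  The eigenvector itself is the switching function: relative to its value at one root, its values
  at the other roots are obtained by multiplying with the signs along a path. The path stays
  among the roots because every vertex on it reaches a root.
\<close>

lemma balanced_if_peripheral_eigenvalue:
  assumes rooted: "rooted G" and ev: "eigenvalue C \<mu>" and \<mu>: "cmod \<mu> \<ge> 1"
  shows "structurally_balanced (G \<restriction> roots G) (matrix_arc_sign A)"
proof -
  obtain x where x: "x \<in> carrier_vec n" "x \<noteq> 0\<^sub>v n" "C *\<^sub>v x = \<mu> \<cdot>\<^sub>v x"
    using ev A unfolding eigenvalue_def eigenvector_def by auto
  note x_roots = peripheral_eigenvector[OF x \<mu>]
  obtain r where r: "r \<in> roots G"
    using rooted by (auto simp: rooted_def)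
  define y where "y i = x $ i / x $ r" for i
  have y_arc: "y j = of_real (sgn (A $$ (i, j))) * y i" if "i \<in> roots G" "j \<rightarrow>\<^bsub>G\<^esub> i" for i j
    using x_roots(3)[OF that(1), of j] that(2) by (simp add: y_def adjacent_G)
  have y_sign: "y i \<in> {1, -1}" if "r \<rightarrow>\<^sup>*\<^bsub>G\<^esub> i" "i \<in> roots G" for i
    using that
  proof (induction rule: digraph.reachable_induct)
    case base
    show ?case using x_roots(2)[OF r] by (simp add: y_def)
  next
    case (step j i)
    then have "y j \<in> {1, -1}"
      using root_if_adjacent_to_root by blast
    then show ?case
      using y_arc[OF step.prems step.hyps(2)] step.hyps(2)
      by (auto simp: adjacent_G sgn_if split: if_splits)
        (metis add.inverse_inverse)
  qed
  have signs: "Re (y i) \<in> {1, -1}" if "i \<in> roots G" for i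
    using y_sign root_reaches r roots_less that by force
  have "matrix_arc_sign A (j, i) = Re (y j) * Re (y i)"
    if "(j, i) \<in> arcs G" "j \<in> roots G" "i \<in> roots G" for i j
  proof -
    have "Re (y j) = sgn (A $$ (i, j)) * Re (y i)"
      using y_arc[of i j] that by (simp add: adjacent_G arcs_G)
    then show ?thesis
      using signs[OF that(3)] by (auto simp: matrix_arc_sign_def)
  qed
  then show ?thesis
    unfolding structurally_balanced_iff_switching[OF digraph.wellformed_induce_subgraph]
    using signs by (intro exI[of _ "\<lambda>i. Re (y i)"]) simp
qed

text \<open>
  The switching function \<open>d\<close> is fixed by the rows of the roots, and it has to be extended to the
  remaining vertices. The matrix \<open>N\<close> arises from \<open>I - A\<close> by replacing the rows of the roots
  with rows of the identity, so a single linear system prescribes \<open>x = d\<close> on the roots and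
  \<open>A x = x\<close> in all other rows.
\<close>

lemma eigenvalue_one_if_balanced:
  assumes rooted: "rooted G"
    and bal: "structurally_balanced (G \<restriction> roots G) (matrix_arc_sign A)"
  shows "eigenvalue C 1"
proof -
  obtain r where r: "r \<in> roots G"
    using rooted by (auto simp: rooted_def)
  obtain d where d: "\<And>i. i \<in> roots G \<Longrightarrow> d i \<in> {1, -1}"
    and switching: "\<forall>e \<in> arcs (G \<restriction> roots G). matrix_arc_sign A e = d (fst e) * d (snd e)"
    using bal unfolding structurally_balanced_iff_switching[OF digraph.wellformed_induce_subgraph]
    by auto
  have d_arc: "sgn (A $$ (i, j)) = d j * d i"
    if "j \<rightarrow>\<^bsub>G\<^esub> i" "j \<in> roots G" "i \<in> roots G" for i j
    using bspec[OF switching, of "(j, i)"] that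
    by (simp add: matrix_arc_sign_def adjacent_G arcs_G)
  define N where "N = mat n n (\<lambda>(i, j). (if i = j then 1 else 0) -
    (if i \<in> roots G then 0 else complex_of_real (A $$ (i, j))))"
  have N: "N \<in> carrier_mat n n"
    by (simp add: N_def)
  have N_entry: "(N *\<^sub>v x) $ i = x $ i - (if i \<in> roots G then 0 else (C *\<^sub>v x) $ i)"
    if "x \<in> carrier_vec n" "i < n" for x i
  proof -
    have "(N *\<^sub>v x) $ i = (\<Sum>j = 0..<n. (if i = j then x $ j else 0)
        - (if i \<in> roots G then 0 else complex_of_real (A $$ (i, j)) * x $ j))"
      using that by (auto simp: N_def scalar_prod_def algebra_simps intro!: sum.cong)
    also have "\<dots> = x $ i - (if i \<in> roots G then 0 else (C *\<^sub>v x) $ i)"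
      using that by (simp add: sum_subtractf mult_entry)
    finally show ?thesis .
  qed
  have "det N \<noteq> 0"
  proof
    \<comment> \<open>A kernel vector of \<open>N\<close> vanishes on the roots and is fixed by \<open>A\<close>, but fixed vectors
        do not vanish at roots.\<close>
    assume "det N = 0"
    then obtain x where x: "x \<in> carrier_vec n" "x \<noteq> 0\<^sub>v n" "N *\<^sub>v x = 0\<^sub>v n"
      using det_0_iff_vec_prod_zero[OF N] by blast
    have x_root: "x $ i = 0" if "i \<in> roots G" for i
      using N_entry[OF x(1), of i] x(3) that roots_less by simp
    have "(C *\<^sub>v x) $ i = x $ i" if "i < n" for i
    proof (cases "i \<in> roots G")
      case True
      have "complex_of_real (A $$ (i, j)) * x $ j = 0" if "j < n" for j
        using root_if_adjacent_to_root[OF _ True, of j] x_root that \<open>i < n\<close>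
        by (cases "A $$ (i, j) = 0") (auto simp: adjacent_G)
      then have "(C *\<^sub>v x) $ i = 0"
        unfolding mult_entry[OF x(1) \<open>i < n\<close>] by (intro sum.neutral) auto
      then show ?thesis
        using x_root[OF True] by simp
    next
      case False
      then show ?thesis
        using N_entry[OF x(1) that] x(3) that by simp
    qed
    then have "C *\<^sub>v x = 1 \<cdot>\<^sub>v x"
      using x A by (intro eq_vecI) auto
    then show False
      using peripheral_eigenvector(2)[OF x(1,2) _ _ r, of 1] x_root[OF r] by simp
  qed
  then obtain N' where N': "N' \<in> carrier_mat n n" "N * N' = 1\<^sub>m n"
    using det_non_zero_imp_unit[OF N] unfolding Units_def ring_mat_def by auto
  define b where "b = vec n (\<lambda>i. if i \<in> roots G then complex_of_real (d i) else 0)"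
  define x where "x = N' *\<^sub>v b"
  have b: "b \<in> carrier_vec n" and x: "x \<in> carrier_vec n"
    using N' by (simp_all add: b_def x_def)
  have Nx: "N *\<^sub>v x = b"
    using N N' b by (simp add: x_def flip: assoc_mult_mat_vec)
  have x_root: "x $ i = d i" if "i \<in> roots G" for i
    using N_entry[OF x, of i] that roots_less by (simp add: Nx b_def)
  have "(C *\<^sub>v x) $ i = x $ i" if "i < n" for i
  proof (cases "i \<in> roots G")
    case True
    have "of_real (A $$ (i, j)) * x $ j = complex_of_real (\<bar>A $$ (i, j)\<bar> * d i)" if "j < n" for j
    proof (cases "A $$ (i, j) = 0")
      case False
      then have j: "j \<rightarrow>\<^bsub>G\<^esub> i" "j \<in> roots G"
        using root_if_adjacent_to_root[OF _ True] that \<open>i < n\<close> by (auto simp: adjacent_G)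
      have "\<bar>A $$ (i, j)\<bar> = A $$ (i, j) * (d j * d i)"
        by (simp add: abs_sgn d_arc[OF j True])
      then have "A $$ (i, j) * d j = \<bar>A $$ (i, j)\<bar> * d i"
        using d[OF True] by auto
      then show ?thesis
        unfolding x_root[OF j(2)] by (simp flip: of_real_mult)
    qed simp
    then have "(C *\<^sub>v x) $ i = complex_of_real (\<Sum>j = 0..<n. \<bar>A $$ (i, j)\<bar> * d i)"
      unfolding mult_entry[OF x \<open>i < n\<close>] by simp
    also have "\<dots> = d i"
      using abs_row_sum[OF \<open>i < n\<close>] by (simp flip: sum_distrib_right)
    finally show ?thesis by (simp add: x_root True)
  next
    case False
    then show ?thesis
      using N_entry[OF x that] that by (simp add: Nx b_def)
  qed
  then have "C *\<^sub>v x = 1 \<cdot>\<^sub>v x"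
    using x A by (intro eq_vecI) auto
  moreover have "x \<noteq> 0\<^sub>v n"
    using x_root[OF r] d[OF r] roots_less[OF r] by auto
  ultimately show ?thesis
    using x A unfolding eigenvalue_def eigenvector_def by auto
qed

text \<open>
  A longer Jordan chain is excluded because its iterates grow, while \<open>A\<close> does not increase the
  maximum norm. A second independent eigenvector is excluded because a fixed vector is determined
  by its entry at a single root.
\<close>

lemma eigenvalue_one_simple:
  assumes rooted: "rooted G"
  shows "count (eigenvalue_mset C) 1 \<le> 1"
proof (rule ccontr)
  assume "\<not> ?thesis"
  then have "2 \<le> count (eigenvalue_mset C) 1"
    by linarith
  then obtain v w c where vectors: "v \<in> carrier_vec n" "w \<in> carrier_vec n" "v \<noteq> 0\<^sub>v n"
    and indep: "\<forall>k. w \<noteq> k \<cdot>\<^sub>v v"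
    and chain: "C *\<^sub>v v = 1 \<cdot>\<^sub>v v" "C *\<^sub>v w = 1 \<cdot>\<^sub>v w + c \<cdot>\<^sub>v v"
    by (rule repeated_eigenvalue_chain[OF C])
  note v = vectors(1,3) chain(1) and w = vectors(2) chain(2)
  obtain r where r: "r \<in> roots G"
    using rooted by (auto simp: rooted_def)
  have vr: "v $ r \<noteq> 0"
    by (rule peripheral_eigenvector(2)[OF v _ r]) simp
  have "c = 0"
  proof (rule ccontr)
    assume "c \<noteq> 0"
    define M where "M = (\<Sum>j = 0..<n. cmod (w $ j))"
    have M: "cmod (w $ j) \<le> M" if "j < n" for j
      unfolding M_def using that by (intro member_le_sum) auto
    \<comment> \<open>\<open>w + k c v\<close> is \<open>A\<^sup>k w\<close>, whose maximum norm is at most that of \<open>w\<close>.\<close>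
    have orbit: "cmod (w $ j + of_nat k * c * v $ j) \<le> M" if "j < n" for j k
      using that
    proof (induction k arbitrary: j)
      case 0
      then show ?case using M by simp
    next
      case (Suc k)
      define z where "z = w + (of_nat k * c) \<cdot>\<^sub>v v"
      have z: "z \<in> carrier_vec n"
        using vectors by (simp add: z_def)
      have "cmod ((C *\<^sub>v z) $ j) \<le> M"
        using Suc vectors by (intro mult_entry_bound[OF z]) (simp_all add: z_def)
      moreover have "(C *\<^sub>v z) $ j = w $ j + of_nat (Suc k) * c * v $ j"
        unfolding z_def mult_add_distrib_mat_vec[OF C w(1) smult_carrier_vec[THEN iffD2, OF v(1)]]
          mult_mat_vec[OF C v(1)] chain
        using vectors Suc.prems by (simp add: distrib_right)
      ultimately show ?case by metis
    qed
    have "0 < cmod (c * v $ r)"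
      using \<open>c \<noteq> 0\<close> vr by simp
    then obtain k :: nat where "M + cmod (w $ r) < real k * cmod (c * v $ r)"
      using reals_Archimedean3 by blast
    moreover have "real k * cmod (c * v $ r) = cmod (of_nat k * c * v $ r)"
      by (simp add: norm_mult)
    moreover have "cmod (of_nat k * c * v $ r) \<le> cmod (w $ r + of_nat k * c * v $ r) + cmod (w $ r)"
      using norm_triangle_ineq4[of "w $ r + of_nat k * c * v $ r" "w $ r"] by simp
    ultimately show False
      using orbit[OF roots_less[OF r], of k] by linarith
  qed
  \<comment> \<open>The combination of the two fixed vectors that vanishes at the root \<open>r\<close>.\<close>
  define u where "u = w - (w $ r / v $ r) \<cdot>\<^sub>v v"
  have u: "u \<in> carrier_vec n"
    using vectors by (simp add: u_def)
  have "C *\<^sub>v u = 1 \<cdot>\<^sub>v u"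
    unfolding u_def mult_minus_distrib_mat_vec[OF C w(1) smult_carrier_vec[THEN iffD2, OF v(1)]]
      mult_mat_vec[OF C v(1)] chain \<open>c = 0\<close>
    using vectors by (intro eq_vecI) simp_all
  then have "u $ r \<noteq> 0" if "u \<noteq> 0\<^sub>v n"
    by (rule peripheral_eigenvector(2)[OF u that _ _ r]) simp
  moreover have "u $ r = 0"
    using vr vectors roots_less[OF r] by (simp add: u_def)
  ultimately have "u = 0\<^sub>v n"
    by blast
  then have "u $ i = 0" if "i < n" for i
    using that by simp
  then have "w = (w $ r / v $ r) \<cdot>\<^sub>v v"
    using vectors by (intro eq_vecI) (simp_all add: u_def)
  with indep show False by blast
qed

end

section \<open>The spectrum of a rooted matrix\<close>

theorem proposition6:
  fixes n :: nat and A :: "real mat"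
  defines "G \<equiv> matrix_digraph A" and "\<sigma> \<equiv> matrix_arc_sign A"
  defines "G\<^sub>R \<equiv> G \<restriction> roots G"
  assumes "n > 1" and "A \<in> carrier_mat n n"
    and "\<And>i. i < n \<Longrightarrow> A $$ (i, i) > 0"
    and "\<And>i. i < n \<Longrightarrow> (\<Sum>j = 0..<n. \<bar>A $$ (i, j)\<bar>) = 1"
    and "structurally_unbalanced G \<sigma>" and "rooted G" and "\<not> strongly_connected G"
  shows "(structurally_unbalanced G\<^sub>R \<sigma> \<longrightarrow>
            (\<forall>\<mu>. eigenvalue (complexify A) \<mu> \<longrightarrow> cmod \<mu> < 1)) \<and>
         (structurally_balanced G\<^sub>R \<sigma> \<longrightarrow>
            eigenvalue (complexify A) 1 \<and>
            (\<forall>\<mu> \<in># eigenvalue_mset (complexify A) - {#1#}. cmod \<mu> < 1))"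
proof -
  interpret signed_stochastic_matrix n A
    by unfold_locales (fact assms)+
  have rooted: "rooted (matrix_digraph A)"
    using \<open>rooted G\<close> by (simp add: G_def)
  have peripheral: "\<mu> = 1 \<and> structurally_balanced G\<^sub>R \<sigma>"
    if ev: "eigenvalue C \<mu>" and \<mu>: "cmod \<mu> \<ge> 1" for \<mu>
  proof
    obtain x where "x \<in> carrier_vec n" "x \<noteq> 0\<^sub>v n" "C *\<^sub>v x = \<mu> \<cdot>\<^sub>v x"
      using ev A unfolding eigenvalue_def eigenvector_def by auto
    then show "\<mu> = 1"
      using peripheral_eigenvector(1) \<mu> by blast
    show "structurally_balanced G\<^sub>R \<sigma>"
      using balanced_if_peripheral_eigenvalue[OF rooted ev \<mu>]
      by (simp add: G\<^sub>R_def G_def \<sigma>_def)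
  qed
  show ?thesis
  proof (intro conjI impI allI ballI)
    show "cmod \<mu> < 1" if "structurally_unbalanced G\<^sub>R \<sigma>" "eigenvalue (complexify A) \<mu>" for \<mu>
      using peripheral[OF that(2)] that(1) by linarith
    show "eigenvalue (complexify A) 1" if "structurally_balanced G\<^sub>R \<sigma>"
      using eigenvalue_one_if_balanced[OF rooted] that by (simp add: G\<^sub>R_def G_def \<sigma>_def)
    show "cmod \<mu> < 1" if "\<mu> \<in># eigenvalue_mset (complexify A) - {#1#}" for \<mu>
    proof -
      have "char_poly C \<noteq> 0"
        using degree_monic_char_poly[OF C] by auto
      then have "eigenvalue C \<mu>"
        using in_diffD[OF that] eigenvalue_root_char_poly[OF C, of \<mu>]
        by (simp add: eigenvalue_mset_def)
      moreover have "\<mu> \<noteq> 1"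
        using that eigenvalue_one_simple[OF rooted] by (auto simp: in_diff_count)
      ultimately show ?thesis
        using peripheral[of \<mu>] by linarith
    qed
  qed
qed

end
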